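(* Let $\mathcal{C}$ be a hereditary small graph class. Then its neighborhood complexity satisfies $\nu_{\mathcal{C}}(n) = O(n\log n)$.
   Context: A class of graphs is a set of graphs closed under isomorphism; it is hereditary if closed under taking induced subgraphs. $\mathcal{C}_n$ denotes the set of graphs in $\mathcal{C}$ with vertex set $[n]$; $\mathcal{C}$ is small if there is a constant $c$ with $|\mathcal{C}_n|\le n!\cdot c^n$ for all $n$. For a vertex $v$ of a graph $G$, $N_G(v)$ is its set of neighbors. The neighborhood complexity of $\mathcal{C}$ is the function $\nu_{\mathcal{C}}(n) := \sup_{G\in\mathcal{C},\ A\subseteq V(G),\ |A|=n} |\{N_G(v)\cap A : v\in V(G)\}|$. *)

theory Defs
  imports Complex_Main "HOL-Library.Landau_Symbols" "Graph_Theory.Digraph_Isomorphism"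
begin

text \<open>
  Graphs are finite, simple and undirected: values of type \<open>nat pair_pre_digraph\<close> satisfying
  \<^const>\<open>pair_graph\<close>, i.e. an undirected edge is a pair of opposite arcs.
  Since every finite graph is isomorphic to one whose vertices are natural numbers, a class of
  graphs is represented by its members with vertices in \<open>nat\<close>.
\<close>

definition graph_class :: "nat pair_pre_digraph set \<Rightarrow> bool" where
  "graph_class C \<longleftrightarrow>
     (\<forall>G\<in>C. pair_graph G) \<and>
     (\<forall>G\<in>C. \<forall>H. pair_graph H \<and> digraph_iso (with_proj G) (with_proj H) \<longrightarrow> H \<in> C)"

definition hereditary :: "nat pair_pre_digraph set \<Rightarrow> bool" where
  "hereditary C \<longleftrightarrow>
     (\<forall>G\<in>C. \<forall>H. pair_graph H \<and> induced_subgraph (with_proj H) (with_proj G) \<longrightarrow> H \<in> C)"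

definition labelled_members :: "nat pair_pre_digraph set \<Rightarrow> nat \<Rightarrow> nat pair_pre_digraph set" where
  "labelled_members C n = {G \<in> C. pverts G = {1..n}}"

definition small :: "nat pair_pre_digraph set \<Rightarrow> bool" where
  "small C \<longleftrightarrow> (\<exists>c::real. \<forall>n. real (card (labelled_members C n)) \<le> fact n * c ^ n)"

definition nbhd :: "'a pair_pre_digraph \<Rightarrow> 'a \<Rightarrow> 'a set" where
  "nbhd G v = {u \<in> pverts G. (v, u) \<in> parcs G}"

text \<open>
  The supremum is taken in \<open>nat\<close>. The values are bounded by \<open>2 ^ n\<close>
  (lemma \<open>bdd_above_traces\<close> below), and if no member of the class has \<open>n\<close> vertices or more, then
  the supremum of the empty set is \<open>0\<close>.
\<close>

definition neighborhood_complexity :: "nat pair_pre_digraph set \<Rightarrow> nat \<Rightarrow> nat" where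
  "neighborhood_complexity C n =
     (SUP (G, A) \<in> {(G, A). G \<in> C \<and> A \<subseteq> pverts G \<and> card A = n}.
        card {nbhd G v \<inter> A | v. v \<in> pverts G})"

lemma bdd_above_traces:
  assumes "graph_class C"
  shows "bdd_above ((\<lambda>(G, A). card {nbhd G v \<inter> A | v. v \<in> pverts G}) `
           {(G, A). G \<in> C \<and> A \<subseteq> pverts G \<and> card A = n})"
proof (rule bdd_aboveI2[where M = "2 ^ n"], clarify)
  fix G and A :: "nat set"
  assume G: "G \<in> C" and A: "A \<subseteq> pverts G" and n: "n = card A"
  interpret pair_graph G using assms G by (auto simp: graph_class_def)
  have "finite A" using A pair_finite_verts by (rule finite_subset)
  then have "card {nbhd G v \<inter> A | v. v \<in> pverts G} \<le> card (Pow A)"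
    by (intro card_mono) auto
  then show "card {nbhd G v \<inter> A | v. v \<in> pverts G} \<le> 2 ^ card A"
    using \<open>finite A\<close> by (simp add: card_Pow)
qed

text \<open>Finiteness makes the use of \<^const>\<open>card\<close> in \<open>small\<close> meaningful.\<close>

lemma finite_labelled_members:
  assumes "graph_class C"
  shows "finite (labelled_members C n)"
proof (rule finite_subset)
  show "labelled_members C n \<subseteq>
      (\<lambda>E. \<lparr>pverts = {1..n}, parcs = E\<rparr>) ` Pow ({1..n} \<times> {1..n})"
  proof
    fix G assume "G \<in> labelled_members C n"
    then have V: "pverts G = {1..n}" and "G \<in> C" by (auto simp: labelled_members_def)
    then interpret pair_graph G using assms by (auto simp: graph_class_def)
    have "parcs G \<subseteq> {1..n} \<times> {1..n}" using wellformed' V by fastforce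
    moreover have "G = \<lparr>pverts = {1..n}, parcs = parcs G\<rparr>" using V by (cases G) simp
    ultimately show "G \<in> (\<lambda>E. \<lparr>pverts = {1..n}, parcs = E\<rparr>) ` Pow ({1..n} \<times> {1..n})"
      by blast
  qed
qed simp

text \<open>The library notions, specialised to the present graphs, read as usual.\<close>

lemma digraph_iso_iff_bij:
  assumes "pair_graph G" "pair_graph H"
  shows "digraph_iso (with_proj G) (with_proj H) \<longleftrightarrow>
    (\<exists>f. bij_betw f (pverts G) (pverts H) \<and>
      (\<forall>u\<in>pverts G. \<forall>v\<in>pverts G. (u, v) \<in> parcs G \<longleftrightarrow> (f u, f v) \<in> parcs H))"
    (is "?L \<longleftrightarrow> (\<exists>f. ?R f)")
proof -
  interpret G: pair_graph G by fact
  interpret H: pair_graph H by fact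
  show ?thesis
  proof
    assume ?L
    then obtain h where h: "G.digraph_isomorphism h" and H: "with_proj H = app_iso h (with_proj G)"
      by (auto simp: digraph_iso_def)
    have vH: "pverts H = iso_verts h ` pverts G" and aH: "parcs H = iso_arcs h ` parcs G"
      and "iso_tail h = fst" "iso_head h = snd"
      using arg_cong[OF H, of verts] arg_cong[OF H, of arcs]
        arg_cong[OF H, of tail] arg_cong[OF H, of head] by simp_all
    then have inj: "inj_on (iso_verts h) (pverts G)"
      and e: "\<And>a. a \<in> parcs G \<Longrightarrow> iso_arcs h a = (iso_verts h (fst a), iso_verts h (snd a))"
      using h by (auto simp: G.digraph_isomorphism_def prod_eq_iff)
    have "(u, v) \<in> parcs G \<longleftrightarrow> (iso_verts h u, iso_verts h v) \<in> parcs H"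
      if "u \<in> pverts G" "v \<in> pverts G" for u v
    proof
      assume "(u, v) \<in> parcs G"
      then show "(iso_verts h u, iso_verts h v) \<in> parcs H"
        using e[of "(u, v)"] aH by force
    next
      assume "(iso_verts h u, iso_verts h v) \<in> parcs H"
      then obtain x y where xy: "(x, y) \<in> parcs G"
        and "iso_arcs h (x, y) = (iso_verts h u, iso_verts h v)" using aH by force
      then have "iso_verts h x = iso_verts h u" "iso_verts h y = iso_verts h v"
        using e[of "(x, y)"] by auto
      then show "(u, v) \<in> parcs G"
        using inj that G.wellformed'[OF xy] xy by (metis inj_onD)
    qed
    then have "?R (iso_verts h)" using inj vH by (auto simp: bij_betw_def)
    then show "\<exists>f. ?R f" by blast
  next
    assume "\<exists>f. ?R f"
    then obtain f where inj: "inj_on f (pverts G)" and im: "f ` pverts G = pverts H"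
      and ad: "\<And>u v. u \<in> pverts G \<Longrightarrow> v \<in> pverts G \<Longrightarrow>
        (u, v) \<in> parcs G \<longleftrightarrow> (f u, f v) \<in> parcs H"
      by (auto simp: bij_betw_def)
    define h where "h = \<lparr>iso_verts = f, iso_arcs = map_prod f f, iso_head = snd, iso_tail = fst\<rparr>"
    have sub: "parcs G \<subseteq> pverts G \<times> pverts G" using G.wellformed' by fastforce
    have "inj_on (map_prod f f) (parcs G)"
      using map_prod_inj_on[OF inj inj] sub by (rule inj_on_subset)
    then have "G.digraph_isomorphism h"
      using inj G.wf_digraph_axioms by (auto simp: G.digraph_isomorphism_def h_def)
    moreover have "map_prod f f ` parcs G = parcs H"
    proof
      show "map_prod f f ` parcs G \<subseteq> parcs H"
      proof (rule image_subsetI)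
        fix a assume a: "a \<in> parcs G"
        then have "(fst a, snd a) \<in> parcs G" by simp
        from ad[OF G.wellformed'[OF this]] this
        have "(f (fst a), f (snd a)) \<in> parcs H" by simp
        then show "map_prod f f a \<in> parcs H" by (simp add: map_prod_def split_beta)
      qed
      show "parcs H \<subseteq> map_prod f f ` parcs G"
      proof (rule subrelI)
        fix a b assume ab: "(a, b) \<in> parcs H"
        then have "a \<in> f ` pverts G" "b \<in> f ` pverts G"
          using im H.wellformed'[OF ab] by simp_all
        then obtain u v where uv: "u \<in> pverts G" "v \<in> pverts G" and fuv: "a = f u" "b = f v"
          by (elim imageE)
        have "(u, v) \<in> parcs G" using ad[OF uv] ab fuv by simp
        then have "map_prod f f (u, v) \<in> map_prod f f ` parcs G" by (rule imageI)
        then show "(a, b) \<in> map_prod f f ` parcs G" using fuv by simp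
      qed
    qed
    then have "with_proj H = app_iso h (with_proj G)"
      using im by (simp add: app_iso_def h_def with_proj_def)
    ultimately show ?L by (auto simp: digraph_iso_def)
  qed
qed

lemma induced_subgraph_iff:
  assumes "pair_graph G" "pair_graph H"
  shows "induced_subgraph (with_proj H) (with_proj G) \<longleftrightarrow>
    pverts H \<subseteq> pverts G \<and> parcs H = parcs G \<inter> pverts H \<times> pverts H"
proof -
  interpret G: pair_graph G by fact
  interpret H: pair_graph H by fact
  have "induced_subgraph (with_proj H) (with_proj G) \<longleftrightarrow>
      pverts H \<subseteq> pverts G \<and> parcs H \<subseteq> parcs G \<and>
      parcs H = {e \<in> parcs G. fst e \<in> pverts H \<and> snd e \<in> pverts H}"
    using G.wf_digraph_axioms H.wf_digraph_axioms
    by (simp add: induced_subgraph_def subgraph_def compatible_def)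
  moreover have "{e \<in> parcs G. fst e \<in> pverts H \<and> snd e \<in> pverts H}
      = parcs G \<inter> pverts H \<times> pverts H"
    by (auto simp: mem_Times_iff simp del: G.wellformed' H.wellformed')
  ultimately show ?thesis by (metis inf_le1)
qed

end

theory Submission
  imports Defs "HOL-Library.FuncSet"
begin

text \<open>
  Let \<open>A\<close> be an \<open>n\<close>-set of vertices and let \<open>B\<close> be a set of vertices outside \<open>A\<close> with pairwise
  distinct traces on \<open>A\<close>. Label \<open>A\<close> by \<open>1..n\<close> once and for all. Every injection of
  \<open>{n+1..n+k}\<close> into \<open>B\<close> then gives a labelled member of the class on \<open>n + k\<close> vertices, and distinct
  injections give distinct graphs, since a vertex of \<open>B\<close> is determined by its trace. Hence
  \<open>(|B| - k) ^ k \<le> (n + k)! c ^ (n + k)\<close>. For \<open>k \<approx> n ln n\<close> the \<open>k\<close>-th root of the right-hand side is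
  \<open>O(n ln n)\<close>, because the surplus factor \<open>(n + k) ^ n\<close> contributes only a constant to the root.
\<close>

text \<open>For injective \<open>h\<close> into the vertices of \<open>G\<close>, this is a copy of
  the induced subgraph on the image of \<open>h\<close>, relabelled so that \<open>h i\<close>
  becomes \<open>i\<close>; this gives the vertex set that \<open>labelled_members\<close> asks
  for.\<close>

definition pullback_graph :: "nat pair_pre_digraph \<Rightarrow> (nat \<Rightarrow> nat) \<Rightarrow> nat \<Rightarrow> nat pair_pre_digraph"
  where "pullback_graph G h N =
    \<lparr>pverts = {1..N}, parcs = {(i, j) \<in> {1..N} \<times> {1..N}. (h i, h j) \<in> parcs G}\<rparr>"

lemma pair_graph_of_finite_symmetric:
  assumes "finite V" "E \<subseteq> V \<times> V" "irrefl E" "sym E"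
  shows "pair_graph \<lparr>pverts = V, parcs = E\<rparr>"
proof -
  have "finite E" using assms(1,2) by (meson finite_SigmaI finite_subset)
  with assms show ?thesis
    by unfold_locales (auto simp: irrefl_def arcs_ends_def arc_to_ends_def symmetric_def)
qed

text \<open>Heredity puts the induced subgraph on the image of \<open>h\<close> into the class, and
  the inverse of \<open>h\<close> is an isomorphism from it onto the pullback.\<close>

lemma pullback_graph_in_labelled_members:
  assumes C: "graph_class C" "hereditary C" and G: "G \<in> C"
    and inj: "inj_on h {1..N}" and h: "h ` {1..N} \<subseteq> pverts G"
  shows "pullback_graph G h N \<in> labelled_members C N"
proof -
  have "pair_graph G" using C(1) G by (auto simp: graph_class_def)
  then interpret pair_graph G .
  have sym: "(v, u) \<in> parcs G" if "(u, v) \<in> parcs G" for u v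
    using that sym_arcs by (auto simp: symmetric_def arcs_ends_def arc_to_ends_def dest: symD)
  have irr: "(u, u) \<notin> parcs G" for u
    using no_loops by fastforce
  let ?V = "h ` {1..N}"
  let ?H = "\<lparr>pverts = ?V, parcs = parcs G \<inter> ?V \<times> ?V\<rparr>"
  have H: "pair_graph ?H"
    by (intro pair_graph_of_finite_symmetric) (auto simp: irrefl_def sym irr intro!: symI)
  have P: "pair_graph (pullback_graph G h N)"
    unfolding pullback_graph_def
    by (intro pair_graph_of_finite_symmetric) (auto simp: irrefl_def sym irr intro!: symI)
  have "induced_subgraph (with_proj ?H) (with_proj G)"
    using h by (subst induced_subgraph_iff[OF \<open>pair_graph G\<close> H]) auto
  then have HC: "?H \<in> C" using C(2) G H by (auto simp: hereditary_def)
  define g where "g = the_inv_into {1..N} h"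
  have g: "g (h i) = i" if "i \<in> {1..N}" for i
    using that inj unfolding g_def by (rule the_inv_into_f_f[rotated])
  have bij: "bij_betw g ?V {1..N}"
    unfolding g_def using inj by (metis bij_betw_the_inv_into inj_on_imp_bij_betw)
  have adj: "(u, v) \<in> parcs ?H \<longleftrightarrow> (g u, g v) \<in> parcs (pullback_graph G h N)"
    if uv: "u \<in> ?V" "v \<in> ?V" for u v
  proof -
    obtain i j where "i \<in> {1..N}" "u = h i" "j \<in> {1..N}" "v = h j" using uv by blast
    then show ?thesis using uv by (simp add: pullback_graph_def g del: atLeastAtMost_iff)
  qed
  have "bij_betw g (pverts ?H) (pverts (pullback_graph G h N))"
    using bij by (simp add: pullback_graph_def)
  then have "digraph_iso (with_proj ?H) (with_proj (pullback_graph G h N))"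
    unfolding digraph_iso_iff_bij[OF H P]
    by (intro exI[of _ g] conjI ballI adj) (simp_all only: pair_pre_digraph.select_convs)
  then have "pullback_graph G h N \<in> C"
    using C(1) HC P unfolding graph_class_def by blast
  then show ?thesis by (simp add: labelled_members_def pullback_graph_def)
qed

lemma card_injections_le_card_labelled_members:
  assumes C: "graph_class C" "hereditary C" and G: "G \<in> C"
    and A: "A \<subseteq> pverts G" "card A = n" "finite A" and B: "B \<subseteq> pverts G - A"
    and traces: "inj_on (\<lambda>v. nbhd G v \<inter> A) B"
  shows "card {f \<in> {n+1..n+k} \<rightarrow>\<^sub>E B. inj_on f {n+1..n+k}} \<le> card (labelled_members C (n + k))"
proof -
  obtain g where "bij_betw g {1..n} A"
    using finite_same_card_bij[of "{1..n}" A] A by auto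
  then have g: "inj_on g {1..n}" "g ` {1..n} = A" by (auto simp: bij_betw_def)
  \<comment> \<open>The labels up to \<open>n\<close> always go to \<open>A\<close> through the same
    \<open>g\<close>; only the remaining \<open>k\<close> labels depend on \<open>f\<close>.\<close>
  define h where "h f = (\<lambda>i. if i \<le> n then g i else f i)" for f :: "nat \<Rightarrow> nat"
  let ?I = "{n+1..n+k}"
  let ?F = "{f \<in> ?I \<rightarrow>\<^sub>E B. inj_on f ?I}"
  let ?\<Phi> = "\<lambda>f. pullback_graph G (h f) (n + k)"
  have "?\<Phi> f \<in> labelled_members C (n + k)" if f: "f \<in> ?F" for f
  proof (rule pullback_graph_in_labelled_members[OF C G])
    have img: "h f ` {1..n} \<subseteq> A"
      unfolding h_def g(2)[symmetric] by (rule image_subsetI) simp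
    have img': "h f ` ?I \<subseteq> B"
    proof (rule image_subsetI)
      fix i assume i: "i \<in> ?I"
      then have "f i \<in> B" using f by (blast dest: PiE_mem)
      then show "h f i \<in> B" using i by (simp add: h_def)
    qed
    have U: "{1..n+k} = {1..n} \<union> ?I" by auto
    have "inj_on (h f) {1..n} \<longleftrightarrow> inj_on g {1..n}" "inj_on (h f) ?I \<longleftrightarrow> inj_on f ?I"
      by (rule inj_on_cong; simp add: h_def)+
    then have "inj_on (h f) {1..n}" "inj_on (h f) ?I" using g(1) f by blast+
    moreover have "h f ` {1..n} \<inter> h f ` ?I = {}"
      using img img' B by (metis Diff_disjoint disjoint_iff subset_iff)
    moreover have "h f ` ({1..n} - ?I) \<inter> h f ` (?I - {1..n}) \<subseteq> h f ` {1..n} \<inter> h f ` ?I"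
      by (intro Int_mono image_mono Diff_subset)
    ultimately show "inj_on (h f) {1..n+k}"
      unfolding U inj_on_Un by (metis subset_empty)
    show "h f ` {1..n+k} \<subseteq> pverts G"
      unfolding U image_Un using img img' A(1) B by (intro Un_least) (erule order_trans, fast)+
  qed
  moreover have "inj_on ?\<Phi> ?F"
  proof (rule inj_onI)
    fix f f' assume f: "f \<in> ?F" and f': "f' \<in> ?F" and eq: "?\<Phi> f = ?\<Phi> f'"
    \<comment> \<open>Adjacency of the label \<open>i\<close> to the labels \<open>1..n\<close>
      encodes the trace of \<open>f i\<close> on \<open>A\<close>, and traces separate the vertices
      of \<open>B\<close>.\<close>
    have eq': "f i = f' i" if i: "i \<in> ?I" for i
    proof -
      have "(f i, a) \<in> parcs G \<longleftrightarrow> (f' i, a) \<in> parcs G" if "a \<in> A" for a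
      proof -
        obtain j where j: "j \<in> {1..n}" "a = g j" using \<open>a \<in> A\<close> g(2) by auto
        have "(i, j) \<in> parcs (?\<Phi> f) \<longleftrightarrow> (i, j) \<in> parcs (?\<Phi> f')" using eq by simp
        then show ?thesis using i j by (simp add: pullback_graph_def h_def)
      qed
      then have "nbhd G (f i) \<inter> A = nbhd G (f' i) \<inter> A" by (auto simp: nbhd_def)
      moreover have "f i \<in> B" "f' i \<in> B" using f f' i by auto
      ultimately show ?thesis using traces by (auto dest: inj_onD)
    qed
    \<comment> \<open>Both functions are \<open>undefined\<close> off \<open>?I\<close>, so
      agreement on \<open>?I\<close> suffices.\<close>
    have "f \<in> ?I \<rightarrow>\<^sub>E B" "f' \<in> ?I \<rightarrow>\<^sub>E B" using f f' by simp_all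
    then show "f = f'" by (rule PiE_ext) (rule eq')
  qed
  ultimately show ?thesis
    by (intro card_inj_on_le[of ?\<Phi>] finite_labelled_members C(1)) auto
qed

text \<open>The number of injections is a falling factorial, none of whose factors is below
  \<open>card B - card I\<close>. Truncated subtraction covers the case of too small a
  \<open>B\<close>.\<close>

lemma power_le_card_injections:
  assumes "finite I" "finite B"
  shows "(card B - card I) ^ card I \<le> card {f \<in> I \<rightarrow>\<^sub>E B. inj_on f I}"
proof -
  have "(\<Prod>i\<in>{0..<card I}. card B - card I) \<le> (\<Prod>i\<in>{0..<card I}. card B - i)"
    by (intro prod_mono) auto
  then show ?thesis
    by (simp add: card_inj_on_subset_funcset[OF assms subset_refl])
qed

text \<open>Both \<open>n\<close> and \<open>t + 1\<close> are at most \<open>exp t\<close>, so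
  their product \<open>X\<close> is at most \<open>exp 2 ^ t\<close>. The surplus
  \<open>X ^ n\<close> is therefore absorbed as one factor \<open>exp 2\<close> per power, and the
  surplus \<open>c ^ n\<close> as one more factor \<open>c\<close>.\<close>

lemma power_add_le_power_of_le_exp:
  fixes c :: real
  assumes c: "c \<ge> 1" and t: "t \<ge> 1" and n: "real n \<le> exp (real t)"
  shows "(c * (real n * (real t + 1))) ^ (n + n * t) \<le> (c\<^sup>2 * exp 2 * (real n * (real t + 1))) ^ (n * t)"
proof -
  define X where "X = real n * (real t + 1)"
  have X: "0 \<le> X" by (simp add: X_def)
  have "X \<le> exp (real t) * exp (real t)"
    unfolding X_def using n exp_ge_add_one_self[of "real t"] by (intro mult_mono) (auto simp: add.commute)
  also have "\<dots> = exp 2 ^ t" by (simp flip: exp_add exp_of_nat_mult)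
  finally have "X ^ n \<le> (exp 2 ^ t) ^ n" using X by (intro power_mono)
  then have X': "X ^ n \<le> exp 2 ^ (n * t)" by (simp add: mult.commute[of t n] flip: power_mult)
  have "c ^ (n + n * t) \<le> c ^ (2 * (n * t))"
    using c t by (intro power_increasing) auto
  then have "c ^ (n + n * t) * (X ^ n * X ^ (n * t)) \<le> c ^ (2 * (n * t)) * (exp 2 ^ (n * t) * X ^ (n * t))"
    using X X' c by (intro mult_mono mult_right_mono) auto
  then show ?thesis
    unfolding X_def[symmetric] power_mult_distrib power_add[of X] power_mult[symmetric]
    by (simp only: mult.assoc)
qed

lemma card_traces_le:
  assumes C: "graph_class C" "hereditary C" and G: "G \<in> C"
    and A: "A \<subseteq> pverts G" "card A = n"
    and c: "c \<ge> 1" "\<And>n. real (card (labelled_members C n)) \<le> fact n * c ^ n"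
    and t: "t \<ge> 1" and n: "n \<ge> 1" "real n \<le> exp (real t)"
  shows "real (card {nbhd G v \<inter> A | v. v \<in> pverts G})
    \<le> (2 + c\<^sup>2 * exp 2) * (real n * (real t + 1))"
proof -
  interpret pair_graph G using C(1) G by (auto simp: graph_class_def)
  have finA: "finite A" using A n by (auto intro: card_ge_0_finite)
  let ?tr = "\<lambda>v. nbhd G v \<inter> A"
  let ?X = "real n * (real t + 1)"
  \<comment> \<open>With this choice \<open>n + k\<close> is exactly \<open>?X\<close>.\<close>
  define k where "k = n * t"
  have k: "k \<ge> 1" "real n + real k = ?X" using n t by (simp_all add: k_def algebra_simps)
  \<comment> \<open>One representative for each trace left by a vertex outside
    \<open>A\<close>.\<close>
  obtain B where B: "B \<subseteq> pverts G - A" "?tr ` (pverts G - A) = ?tr ` B" "inj_on ?tr B"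
    using subset_image_inj[of "?tr ` (pverts G - A)" ?tr "pverts G - A"] by auto
  have finB: "finite B" using B(1) finite_subset by (meson finite_Diff pair_finite_verts)
  have "real (card B) \<le> real k + c\<^sup>2 * exp 2 * ?X"
  proof (cases "k \<le> card B")
    case True
    have "(card B - k) ^ k \<le> card (labelled_members C (n + k))"
      using power_le_card_injections[of "{n+1..n+k}" B]
        card_injections_le_card_labelled_members[OF C G A finA B(1,3), of k] finB True
      by simp
    then have "real (card B - k) ^ k \<le> real (card (labelled_members C (n + k)))"
      by (metis of_nat_le_iff of_nat_power)
    also have "\<dots> \<le> fact (n + k) * c ^ (n + k)" by (rule c(2))
    \<comment> \<open>Bounding the factorial by a power of \<open>n + k\<close> makes the whole
      bound a pure power, ready for the \<open>k\<close>-th root.\<close>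
    also have "\<dots> \<le> real (n + k) ^ (n + k) * c ^ (n + k)"
      using c(1) fact_le_power[of "n + k", where 'a = real] by (intro mult_right_mono) auto
    also have "\<dots> = (c * ?X) ^ (n + k)"
      using k(2) by (simp add: power_mult_distrib mult.commute)
    also have "\<dots> \<le> (c\<^sup>2 * exp 2 * ?X) ^ k"
      unfolding k_def by (rule power_add_le_power_of_le_exp[OF c(1) t n(2)])
    finally have "real (card B - k) \<le> c\<^sup>2 * exp 2 * ?X"
      using k(1) by (subst (asm) power_mono_iff) auto
    then show ?thesis using True by simp
  next
    case False
    moreover have "0 \<le> c\<^sup>2 * exp 2 * ?X" by simp
    ultimately show ?thesis by linarith
  qed
  \<comment> \<open>Vertices of \<open>A\<close> add at most \<open>n\<close> traces. Since
    \<open>n + k\<close> equals \<open>?X\<close>, the total is at most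
    \<open>(1 + c\<^sup>2 * exp 2) * ?X\<close>; the 2 in the statement is slack.\<close>
  moreover have "card {?tr v | v. v \<in> pverts G} \<le> n + card B"
  proof -
    have "{?tr v | v. v \<in> pverts G} = ?tr ` A \<union> ?tr ` B"
      unfolding B(2)[symmetric] using A(1) by auto
    also have "card \<dots> \<le> card (?tr ` A) + card (?tr ` B)" by (rule card_Un_le)
    also have "\<dots> \<le> n + card B"
      using card_image_le[OF finA, of ?tr] card_image_le[OF finB, of ?tr] A(2) by linarith
    finally show ?thesis .
  qed
  moreover have "0 \<le> ?X" by simp
  ultimately show ?thesis using k(2) unfolding distrib_right by linarith
qed

theorem theorem1p4:
  fixes C :: "nat pair_pre_digraph set"
  assumes "graph_class C" and "hereditary C" and "small C"
  shows "(\<lambda>n. real (neighborhood_complexity C n)) \<in> O(\<lambda>n. real n * ln (real n))"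
proof -
  obtain c0 where c0: "\<And>n. real (card (labelled_members C n)) \<le> fact n * c0 ^ n"
    using assms(3) by (auto simp: small_def)
  \<comment> \<open>The constant given by smallness may be below 1 or negative; raising the exponent
    of \<open>c\<close> later needs a base of at least 1.\<close>
  define c where "c = max 1 \<bar>c0\<bar>"
  have c: "c \<ge> 1" "real (card (labelled_members C n)) \<le> fact n * c ^ n" for n
  proof -
    have "c0 ^ n \<le> \<bar>c0\<bar> ^ n" by (metis abs_ge_self power_abs)
    also have "\<dots> \<le> c ^ n" by (intro power_mono) (auto simp: c_def)
    finally show "real (card (labelled_members C n)) \<le> fact n * c ^ n"
      using c0[of n] by (meson fact_ge_zero mult_left_mono order_trans)
  qed (simp add: c_def)
  define K where "K = 2 + c\<^sup>2 * exp 2"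
  have K: "K \<ge> 0" by (simp add: K_def)
  \<comment> \<open>From 3 on, \<open>n\<close> is at least \<open>exp 1\<close>, so
    \<open>ln n\<close> is at least 1. Hence \<open>t + 1\<close>, being at most
    \<open>ln n + 2\<close>, is at most \<open>3 * ln n\<close>, which is the source of the factor
    3.\<close>
  have "real (neighborhood_complexity C n) \<le> 3 * K * (real n * ln (real n))" if n: "n \<ge> 3" for n
  proof -
    have "ln (exp 1) \<le> ln (real n)" using n exp_le by (subst ln_le_cancel_iff) auto
    then have ln: "1 \<le> ln (real n)" by simp
    define t where "t = nat \<lceil>ln (real n)\<rceil>"
    have t: "ln (real n) \<le> real t" "real t \<le> ln (real n) + 1" "t \<ge> 1"
      using ln unfolding t_def by linarith+
    have "exp (ln (real n)) \<le> exp (real t)" using t(1) by simp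
    then have "real n \<le> exp (real t)" using n by simp
    then have bound: "real (card {nbhd G v \<inter> A | v. v \<in> pverts G}) \<le> K * (real n * (real t + 1))"
      if "G \<in> C" "A \<subseteq> pverts G" "card A = n" for G A
      unfolding K_def using card_traces_le[OF assms(1,2) that c t(3)] n by simp
    let ?S = "{(G, A). G \<in> C \<and> A \<subseteq> pverts G \<and> card A = n}"
    have "real (neighborhood_complexity C n) \<le> K * (real n * (real t + 1))"
    proof (cases "?S = {}")
      \<comment> \<open>The empty supremum in \<open>nat\<close> is 0.\<close>
      case True
      then show ?thesis
        unfolding neighborhood_complexity_def True using K by (simp add: Sup_nat_def)
    next
      case False
      \<comment> \<open>The supremum lives in \<open>nat\<close>, so the real bound is first rounded
        down.\<close>
      then have "neighborhood_complexity C n \<le> nat \<lfloor>K * (real n * (real t + 1))\<rfloor>"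
        unfolding neighborhood_complexity_def
        using bound by (intro cSUP_least) (auto intro!: le_nat_floor)
      then show ?thesis using K by (simp add: le_nat_iff le_floor_iff)
    qed
    also have "\<dots> \<le> K * (real n * (3 * ln (real n)))"
      using K t(2) ln by (intro mult_left_mono) auto
    finally show ?thesis by simp
  qed
  then show ?thesis
    using K by (intro bigoI[of _ "3 * K"] eventually_sequentiallyI[of 3]) auto
qed

end
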